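(* Let $\mathcal{H}_u$ be a separable Hilbert space equipped with the Gaussian measure $\mu_0=\mathcal{N}(0,\mathcal{C}_0)$ and let $\mathcal{H}$ be the Cameron-Martin space of $\mu_0$. For $n=1,\ldots,N$ let $v_n\in\mathcal{H}_u$, $b_n\in\mathbb{R}$, and $$f_{\theta_n}^{(n)}(u)=u+\mathcal{F}_{\theta_n}^{(n)}(u),\qquad \mathcal{F}_{\theta_n}^{(n)}(u)=-0.5\,v_n\big(\langle v_n,u\rangle_{\mathcal{H}_u}+b_n\big),\qquad u\in\mathcal{H}_u .$$ Assume that for all $n=1,\ldots,N$: $v_n\in\mathcal{H}$ and $\langle v_n,v_n\rangle_{\mathcal{H}_u}=1$. Then for all $n=1,\ldots,N$: (1) $\mathrm{Im}(\mathcal{F}_{\theta_n}^{(n)})\subset\mathcal{H}$; (2) $\mathcal{F}_{\theta_n}^{(n)}$ has finite dimensional range; (3) $f_{\theta_n}^{(n)}:\mathcal{H}_u\to\mathcal{H}_u$ is bijective; (4) for any $u\in\mathcal{H}_u$, no element of the point spectrum of the Fréchet derivative $D\mathcal{F}_{\theta_n}^{(n)}(u)$ lies in $(-\infty,-1]$.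
   Context: "Finite dimensional range" means the image is contained in a finite-dimensional linear subspace. The parameters of the layer are $\theta_n=\{v_n,b_n\}$. The Cameron-Martin space $\mathcal{H}\subset\mathcal{H}_u$ of $\mathcal{N}(0,\mathcal{C}_0)$ carries the inner product $\langle u,v\rangle_{\mathcal{H}}=\langle\mathcal{C}_0^{-1/2}u,\mathcal{C}_0^{-1/2}v\rangle_{\mathcal{H}_u}$. *)

theory Defs
  imports "HOL-Probability.Probability"
begin

(* Gaussian law on the real line with the degenerate case s = 0 (Dirac mass) included, since a
   Gaussian measure on a Hilbert space may have degenerate one-dimensional marginals. *)
definition real_gaussian :: "real \<Rightarrow> real \<Rightarrow> real measure" where
  "real_gaussian m s =
     (if s = 0 then return borel m else density lborel (\<lambda>x. ennreal (normal_density m s x)))"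

definition gaussian_measure :: "'a::{real_inner, complete_space, second_countable_topology} measure \<Rightarrow> bool" where
  "gaussian_measure M \<longleftrightarrow>
     prob_space M \<and> sets M = sets borel \<and>
     (\<forall>h. \<exists>m s. s \<ge> 0 \<and> distr M borel (\<lambda>x. h \<bullet> x) = real_gaussian m s)"

(* M = N(m, C).  The mean and the covariance operator are characterised weakly; symmetry,
   nonnegativity and the trace-class property of C follow. *)
definition gaussian_measure_with ::
  "'a::{real_inner, complete_space, second_countable_topology} \<Rightarrow> ('a \<Rightarrow> 'a) \<Rightarrow> 'a measure \<Rightarrow> bool" where
  "gaussian_measure_with m C M \<longleftrightarrow>
     gaussian_measure M \<and>
     (\<forall>h. (LINT x|M. h \<bullet> x) = h \<bullet> m) \<and>
     bounded_linear C \<and>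
     (\<forall>h k. C h \<bullet> k = (LINT x|M. (h \<bullet> (x - m)) * (k \<bullet> (x - m))))"

definition nonneg_operator :: "('a::real_inner \<Rightarrow> 'a) \<Rightarrow> bool" where
  "nonneg_operator T \<longleftrightarrow>
     bounded_linear T \<and> (\<forall>x y. T x \<bullet> y = x \<bullet> T y) \<and> (\<forall>x. 0 \<le> T x \<bullet> x)"

(* A bounded self-adjoint nonnegative operator on a Hilbert space has exactly one square root of
   the same kind. *)
definition operator_sqrt :: "('a::real_inner \<Rightarrow> 'a) \<Rightarrow> ('a \<Rightarrow> 'a)" where
  "operator_sqrt T = (THE S. nonneg_operator S \<and> S \<circ> S = T)"

(* The underlying vector space of the Cameron-Martin space of N(0, C): the range of the square
   root of C, i.e. the domain of its inverse.  C is not required to be injective. *)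
definition cameron_martin_space :: "('a::real_inner \<Rightarrow> 'a) \<Rightarrow> 'a set" where
  "cameron_martin_space C = range (operator_sqrt C)"

definition layer_perturbation :: "'a::real_inner \<Rightarrow> real \<Rightarrow> 'a \<Rightarrow> 'a" where
  "layer_perturbation v b u = (- 0.5 * (v \<bullet> u + b)) *\<^sub>R v"

definition layer :: "'a::real_inner \<Rightarrow> real \<Rightarrow> 'a \<Rightarrow> 'a" where
  "layer v b u = u + layer_perturbation v b u"

definition finite_dimensional_range :: "('a \<Rightarrow> 'b::real_vector) \<Rightarrow> bool" where
  "finite_dimensional_range F \<longleftrightarrow>
     (\<exists>V. subspace V \<and> (\<exists>B. finite B \<and> span B = V) \<and> range F \<subseteq> V)"

definition point_spectrum :: "('a::real_vector \<Rightarrow> 'a) \<Rightarrow> real set" where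
  "point_spectrum T = {l. \<exists>x. x \<noteq> 0 \<and> T x = l *\<^sub>R x}"

end

theory Submission
  imports Defs
begin

text \<open>The layer is a rank-one affine perturbation of the identity, so (2), (3) and (4) are direct
  computations. For (1) one needs that the range of \<open>operator_sqrt C\<^sub>0\<close> is a linear subspace, which
  rests on the existence and uniqueness of nonnegative square roots. Existence: after rescaling,
  \<open>C = 1 - A\<close> with \<open>A\<close> a contraction, and the iteration \<open>Y \<mapsto> (A + Y\<^sup>2) / 2\<close> started at \<open>0\<close>
  converges to a \<open>Y\<close> with \<open>(1 - Y)\<^sup>2 = 1 - A\<close>, because its increments are dominated in norm by
  those of the same iteration for the scalar \<open>1\<close>. Uniqueness: the root so obtained commutes with
  every operator commuting with \<open>C\<close>, in particular with any other root.\<close>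

section \<open>Nonnegative operators\<close>

lemma nonneg_operatorD:
  assumes "nonneg_operator T"
  shows "bounded_linear T" "T x \<bullet> y = x \<bullet> T y" "0 \<le> T x \<bullet> x"
  using assms by (auto simp: nonneg_operator_def)

lemma nonneg_operator_scaleR:
  assumes "nonneg_operator T" "0 \<le> c"
  shows "nonneg_operator (\<lambda>x. c *\<^sub>R T x)"
  using assms by (auto simp: nonneg_operator_def intro: bounded_linear_const_scaleR)

text \<open>Expand the nonnegative form of \<open>T\<close> at \<open>x - t T x\<close> and bound
  the quadratic term by \<open>K\<close>. The estimate serves twice: it puts null vectors of the
  form into the kernel, and it makes \<open>1 - C / K\<close> a contraction.\<close>

lemma nonneg_operator_norm_le:
  assumes T: "nonneg_operator T" and K: "0 < K" "\<And>x. norm (T x) \<le> K * norm x"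
  shows "(norm (T x))\<^sup>2 \<le> K * (T x \<bullet> x)"
proof -
  interpret T: bounded_linear T using T by (rule nonneg_operatorD)
  \<comment> \<open>The factor \<open>1 / K\<close> is the minimiser of
    \<open>- 2 t + K t^2\<close>.\<close>
  define y where "y = x - (1 / K) *\<^sub>R T x"
  have "T (T x) \<bullet> T x \<le> norm (T (T x)) * norm (T x)"
    by (rule norm_cauchy_schwarz)
  also have "\<dots> \<le> (K * norm (T x)) * norm (T x)"
    using K(2) by (intro mult_right_mono) auto
  finally have le: "T (T x) \<bullet> T x \<le> K * (norm (T x))\<^sup>2"
    by (simp add: power2_eq_square mult.assoc)
  have "0 \<le> T y \<bullet> y"
    using T by (rule nonneg_operatorD)
  also have "T y \<bullet> y = T x \<bullet> x - (2 / K) * (norm (T x))\<^sup>2 + (1 / K\<^sup>2) * (T (T x) \<bullet> T x)"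
    using nonneg_operatorD(2)[OF T, of "T x" x]
    by (simp add: y_def T.diff T.scaleR inner_diff_left inner_diff_right power2_norm_eq_inner
        power2_eq_square[of K] diff_divide_distrib)
  also have "\<dots> \<le> T x \<bullet> x - (2 / K) * (norm (T x))\<^sup>2 + (1 / K\<^sup>2) * (K * (norm (T x))\<^sup>2)"
    using le K(1) by (intro add_left_mono mult_left_mono) auto
  also have "\<dots> = T x \<bullet> x - (norm (T x))\<^sup>2 / K"
    using K(1) by (simp add: field_simps power2_eq_square)
  finally show ?thesis
    using K(1) by (simp add: field_simps)
qed

lemma nonneg_operator_eq_0:
  assumes T: "nonneg_operator T" and "T x \<bullet> x = 0"
  shows "T x = 0"
proof -
  obtain K where K: "K > 0" "\<And>x. norm (T x) \<le> norm x * K"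
    using bounded_linear.pos_bounded[OF nonneg_operatorD(1)[OF T]] by blast
  show ?thesis
    using nonneg_operator_norm_le[OF T K(1), of x] K(2) assms(2) by (simp add: mult.commute)
qed

section \<open>Square roots of nonnegative operators\<close>

primrec sqrt_iter :: "('a::real_vector \<Rightarrow> 'a) \<Rightarrow> nat \<Rightarrow> 'a \<Rightarrow> 'a" where
  "sqrt_iter A 0 = (\<lambda>x. 0)"
| "sqrt_iter A (Suc n) = (\<lambda>x. (1 / 2) *\<^sub>R (A x + sqrt_iter A n (sqrt_iter A n x)))"

text \<open>Majorant for the operator iteration: it increases and stays below 1, so its increments
  are summable.\<close>

primrec scalar_iter :: "nat \<Rightarrow> real" where
  "scalar_iter 0 = 0"
| "scalar_iter (Suc n) = (1 + (scalar_iter n)\<^sup>2) / 2"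

lemma scalar_iter_bounds: "0 \<le> scalar_iter n" "scalar_iter n \<le> 1"
proof (induction n)
  case (Suc n)
  { case 1 then show ?case by simp }
  { case 2 then show ?case using Suc by (simp add: power_le_one) }
qed auto

lemma incseq_scalar_iter: "incseq scalar_iter"
proof (rule incseq_SucI)
  fix n
  \<comment> \<open>This square is twice the increment from \<open>n\<close> to
    \<open>Suc n\<close>.\<close>
  have "0 \<le> (1 - scalar_iter n)\<^sup>2" by simp
  then show "scalar_iter n \<le> scalar_iter (Suc n)"
    by (simp add: power2_diff)
qed

lemma linear_sqrt_iter:
  assumes "linear A"
  shows "linear (sqrt_iter A n)"
proof (induction n)
  case 0
  show ?case by (simp add: linear_zero)
next
  case (Suc n)
  show ?case
    unfolding sqrt_iter.simps
    using linear_compose[OF Suc Suc]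
    by (intro linear_compose_scale_right linear_compose_add assms) (simp add: o_def)
qed

lemma sqrt_iter_symmetric:
  fixes A :: "'a::real_inner \<Rightarrow> 'a"
  assumes "\<And>x y. A x \<bullet> y = x \<bullet> A y"
  shows "sqrt_iter A n x \<bullet> y = x \<bullet> sqrt_iter A n y"
  by (induction n arbitrary: x y) (simp_all add: assms inner_add_left inner_add_right)

text \<open>Each iterate is built from \<open>A\<close> by sums, compositions and scaling, all of
  which respect commutation with a linear \<open>B\<close>. In the limit this yields the commutation
  property behind uniqueness of roots.\<close>

lemma sqrt_iter_commute:
  assumes "linear B" "\<And>x. B (A x) = A (B x)"
  shows "B (sqrt_iter A n x) = sqrt_iter A n (B x)"
  by (induction n arbitrary: x)
    (simp_all add: assms linear_0 linear_add linear_cmul)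

lemma norm_sqrt_iter_le:
  fixes A :: "'a::real_normed_vector \<Rightarrow> 'a"
  assumes "\<And>x. norm (A x) \<le> norm x"
  shows "norm (sqrt_iter A n x) \<le> scalar_iter n * norm x"
proof (induction n arbitrary: x)
  case (Suc n)
  have "norm (A x + sqrt_iter A n (sqrt_iter A n x))
      \<le> norm x + scalar_iter n * (scalar_iter n * norm x)"
    by (intro norm_triangle_mono assms order.trans[OF Suc] mult_left_mono Suc scalar_iter_bounds)
  then show ?case
    by (simp add: power2_eq_square distrib_right mult.assoc del: scaleR_right_distrib)
qed simp

lemma norm_sqrt_iter_Suc_diff_le:
  fixes A :: "'a::real_normed_vector \<Rightarrow> 'a"
  assumes A: "linear A" "\<And>x. norm (A x) \<le> norm x"
  shows "norm (sqrt_iter A (Suc n) x - sqrt_iter A n x)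
    \<le> (scalar_iter (Suc n) - scalar_iter n) * norm x"
proof (induction n arbitrary: x)
  case 0
  show ?case using A(2)[of x] by simp
next
  case (Suc n)
  define Y where "Y = sqrt_iter A"
  define s where "s = scalar_iter"
  note IH = Suc[folded Y_def s_def]
  have bound: "norm (Y k z) \<le> s k * norm z" for k z
    unfolding Y_def s_def by (rule norm_sqrt_iter_le[OF A(2)])
  have s: "0 \<le> s k" "s k \<le> s (Suc k)" for k
    using scalar_iter_bounds incseq_scalar_iter by (auto simp: s_def incseq_Suc_iff simp del: scalar_iter.simps)
  have "Y (Suc (Suc n)) x - Y (Suc n) x
      = (1 / 2) *\<^sub>R (Y (Suc n) (Y (Suc n) x) - Y n (Y n x))"
    by (simp add: Y_def algebra_simps)
  \<comment> \<open>Noncommutative form of \<open>a^2 - b^2 = a (a - b) + (a - b) b\<close>, so that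
    the induction hypothesis applies to both summands.\<close>
  also have "Y (Suc n) (Y (Suc n) x) - Y n (Y n x)
      = Y (Suc n) (Y (Suc n) x - Y n x) + (Y (Suc n) (Y n x) - Y n (Y n x))"
    using linear_diff[OF linear_sqrt_iter[OF A(1)], of "Suc n"] by (simp add: Y_def del: sqrt_iter.simps)
  finally have eq: "norm (Y (Suc (Suc n)) x - Y (Suc n) x) =
    norm (Y (Suc n) (Y (Suc n) x - Y n x) + (Y (Suc n) (Y n x) - Y n (Y n x))) / 2"
    by simp
  have "norm (Y (Suc n) (Y (Suc n) x - Y n x) + (Y (Suc n) (Y n x) - Y n (Y n x)))
      \<le> s (Suc n) * ((s (Suc n) - s n) * norm x) + (s (Suc n) - s n) * (s n * norm x)"
    by (intro norm_triangle_mono order.trans[OF bound] order.trans[OF IH] mult_left_mono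
        bound IH s diff_ge_0_iff_ge[THEN iffD2])
  \<comment> \<open>The bound is \<open>s (Suc n)^2 - s n^2\<close> times the norm, which is exactly
    twice the next scalar increment.\<close>
  also have "\<dots> = 2 * ((s (Suc (Suc n)) - s (Suc n)) * norm x)"
    by (simp add: s_def field_simps power2_eq_square)
  finally show ?case
    using eq by (simp add: Y_def s_def del: sqrt_iter.simps scalar_iter.simps)
qed

lemma norm_sqrt_iter_diff_le:
  fixes A :: "'a::real_normed_vector \<Rightarrow> 'a"
  assumes "linear A" "\<And>x. norm (A x) \<le> norm x" and "n \<le> m"
  shows "norm (sqrt_iter A m x - sqrt_iter A n x) \<le> (scalar_iter m - scalar_iter n) * norm x"
  using assms(3)
proof (induction m rule: dec_induct)
  case (step m)
  have "norm (sqrt_iter A (Suc m) x - sqrt_iter A n x)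
      \<le> norm (sqrt_iter A (Suc m) x - sqrt_iter A m x) + norm (sqrt_iter A m x - sqrt_iter A n x)"
    by (metis diff_add_cancel add_diff_eq norm_triangle_ineq)
  also have "\<dots> \<le> (scalar_iter (Suc m) - scalar_iter m) * norm x
      + (scalar_iter m - scalar_iter n) * norm x"
    by (intro add_mono step.IH norm_sqrt_iter_Suc_diff_le assms)
  finally show ?case
    by (simp only: algebra_simps)
qed simp

text \<open>The scalar sequence converges, hence is Cauchy; domination of the differences transfers
  this to the iterates at \<open>x\<close>, and completeness gives the limit.\<close>

lemma convergent_sqrt_iter:
  fixes A :: "'a::{real_normed_vector, complete_space} \<Rightarrow> 'a"
  assumes A: "linear A" "\<And>x. norm (A x) \<le> norm x"
  shows "convergent (\<lambda>n. sqrt_iter A n x)"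
proof -
  obtain l where "scalar_iter \<longlonglongrightarrow> l"
    using incseq_convergent[OF incseq_scalar_iter] scalar_iter_bounds(2) by blast
  then have "Cauchy (\<lambda>n. scalar_iter n * norm x)"
    using LIMSEQ_imp_Cauchy tendsto_mult_right by blast
  have "Cauchy (\<lambda>n. sqrt_iter A n x)"
  proof (rule CauchyI')
    fix e :: real assume "e > 0"
    then obtain M where M: "\<And>m n. m \<ge> M \<Longrightarrow> n > m \<Longrightarrow>
        norm (scalar_iter m * norm x - scalar_iter n * norm x) < e"
      using CauchyD[OF \<open>Cauchy (\<lambda>n. scalar_iter n * norm x)\<close> \<open>e > 0\<close>]
      by (meson less_imp_le order.trans)
    show "\<exists>M. \<forall>m\<ge>M. \<forall>n>m. dist (sqrt_iter A m x) (sqrt_iter A n x) < e"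
    proof (intro exI allI impI)
      fix m n assume "m \<ge> M" "n > m"
      then have "norm (sqrt_iter A n x - sqrt_iter A m x) < e"
        using norm_sqrt_iter_diff_le[OF A, of m n x] M[of m n] by (simp add: algebra_simps)
      then show "dist (sqrt_iter A m x) (sqrt_iter A n x) < e"
        by (simp add: dist_norm norm_minus_commute)
    qed
  qed
  then show ?thesis
    by (rule Cauchy_convergent)
qed

text \<open>The root is \<open>1 - Y\<close> for the pointwise limit \<open>Y\<close> of the
  iterates, which inherits linearity, symmetry and the norm bound 1. The commutation clause is
  recorded for the uniqueness proof.\<close>

lemma contraction_sqrt_exists:
  fixes A :: "'a::{real_inner, complete_space} \<Rightarrow> 'a"
  assumes A: "linear A" "\<And>x. norm (A x) \<le> norm x" "\<And>x y. A x \<bullet> y = x \<bullet> A y"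
  obtains S where "nonneg_operator S" "\<And>x. S (S x) = x - A x"
    "\<And>B x. bounded_linear B \<Longrightarrow> (\<And>x. B (A x) = A (B x)) \<Longrightarrow> B (S x) = S (B x)"
proof -
  define Y where "Y x = lim (\<lambda>n. sqrt_iter A n x)" for x
  have lim: "(\<lambda>n. sqrt_iter A n x) \<longlonglongrightarrow> Y x" for x
    unfolding Y_def using convergent_sqrt_iter[OF A(1,2)] by (simp add: convergent_LIMSEQ_iff)
  have iter_le: "norm (sqrt_iter A n x) \<le> norm x" for n x
    using norm_sqrt_iter_le[OF A(2), of n x] mult_right_mono[OF scalar_iter_bounds(2)[of n], of "norm x"]
    by simp
  have Y_le: "norm (Y x) \<le> norm x" for x
    by (rule LIMSEQ_le_const2[OF tendsto_norm[OF lim]]) (use iter_le in auto)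
  have Y_add: "Y (x + y) = Y x + Y y" for x y
    by (rule LIMSEQ_unique[OF lim])
      (use tendsto_add[OF lim lim] in \<open>simp add: linear_add[OF linear_sqrt_iter[OF A(1)]]\<close>)
  have Y_scaleR: "Y (c *\<^sub>R x) = c *\<^sub>R Y x" for c x
    by (rule LIMSEQ_unique[OF lim])
      (use tendsto_scaleR[OF tendsto_const lim] in \<open>simp add: linear_cmul[OF linear_sqrt_iter[OF A(1)]]\<close>)
  have Y_lin: "bounded_linear Y"
    by (rule bounded_linear_intro[where K = 1]) (use Y_add Y_scaleR Y_le in auto)
  then interpret Y: bounded_linear Y .
  have Y_sym: "Y x \<bullet> y = x \<bullet> Y y" for x y
    by (rule LIMSEQ_unique[OF tendsto_inner[OF lim tendsto_const]])
      (use tendsto_inner[OF tendsto_const lim] in \<open>simp add: sqrt_iter_symmetric[OF A(3)]\<close>)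
  have Y_comm: "B (Y x) = Y (B x)"
    if B: "bounded_linear B" "\<And>x. B (A x) = A (B x)" for B x
    using bounded_linear.tendsto[OF B(1) lim[of x]]
    by (simp add: sqrt_iter_commute[where B = B and A = A, OF bounded_linear.linear[OF B(1)] B(2)] LIMSEQ_unique[OF lim])
  have Y_fix: "Y x = (1 / 2) *\<^sub>R (A x + Y (Y x))" for x
  proof -
    \<comment> \<open>Passing to the limit in the square: with \<open>Y_n\<close> for the iterates,
      \<open>Y_n (Y_n x) = Y_n (Y_n x - Y x) + Y_n (Y x)\<close>. The first term vanishes because
      all \<open>Y_n\<close> have norm at most 1.\<close>
    have "(\<lambda>n. sqrt_iter A n (sqrt_iter A n x - Y x)) \<longlonglongrightarrow> 0"
    proof (rule Lim_null_comparison)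
      show "(\<lambda>n. norm (sqrt_iter A n x - Y x)) \<longlonglongrightarrow> 0"
        using lim[of x] by (simp add: LIM_zero tendsto_norm_zero)
    qed (use iter_le in auto)
    from tendsto_add[OF this lim[of "Y x"]]
    have "(\<lambda>n. sqrt_iter A n (sqrt_iter A n x)) \<longlonglongrightarrow> Y (Y x)"
      by (simp add: linear_diff[OF linear_sqrt_iter[OF A(1)]])
    then have "(\<lambda>n. sqrt_iter A (Suc n) x) \<longlonglongrightarrow> (1 / 2) *\<^sub>R (A x + Y (Y x))"
      by (auto intro!: tendsto_intros)
    then show ?thesis
      using LIMSEQ_unique[OF LIMSEQ_Suc[OF lim]] by blast
  qed
  show ?thesis
  proof (rule that[of "\<lambda>x. x - Y x"])
    \<comment> \<open>This is nonnegativity of \<open>1 - Y\<close>, by Cauchy-Schwarz and the norm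
      bound.\<close>
    have "Y x \<bullet> x \<le> x \<bullet> x" for x
      using norm_cauchy_schwarz[of "Y x" x] mult_right_mono[OF Y_le[of x], of "norm x"]
      by (simp add: dot_square_norm power2_eq_square)
    then show "nonneg_operator (\<lambda>x. x - Y x)"
      unfolding nonneg_operator_def
      by (auto simp: inner_diff_left inner_diff_right Y_sym
          intro!: bounded_linear_sub bounded_linear_ident Y_lin)
  next
    fix x
    have "2 *\<^sub>R Y x = A x + Y (Y x)"
      by (subst Y_fix) simp
    then show "(x - Y x) - Y (x - Y x) = x - A x"
      by (simp add: Y.diff scaleR_2 algebra_simps)
  next
    fix B x assume B: "bounded_linear B" "\<And>x. B (A x) = A (B x)"
    show "B (x - Y x) = B x - Y (B x)"
      by (simp add: linear_diff[OF bounded_linear.linear[OF B(1)]] Y_comm[OF B])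
  qed
qed

lemma nonneg_operator_sqrt_exists:
  fixes C :: "'a::{real_inner, complete_space} \<Rightarrow> 'a"
  assumes C: "nonneg_operator C"
  obtains S where "nonneg_operator S" "S \<circ> S = C"
    "\<And>B x. bounded_linear B \<Longrightarrow> (\<And>x. B (C x) = C (B x)) \<Longrightarrow> B (S x) = S (B x)"
proof -
  interpret C: bounded_linear C using C by (rule nonneg_operatorD)
  obtain K where K: "K > 0" "\<And>x. norm (C x) \<le> norm x * K"
    using C.pos_bounded by blast
  define A where "A x = x - (1 / K) *\<^sub>R C x" for x
  have A_lin: "linear A"
    unfolding A_def
    by (intro linear_compose_sub linear_compose_scale_right linear_ident C.linear)
  have A_le: "norm (A x) \<le> norm x" for x
  proof -
    \<comment> \<open>Half of the cross term \<open>(2 / K) * (C x \<bullet> x)\<close> absorbs the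
      quadratic term; the other half has a favourable sign.\<close>
    have *: "(norm (C x))\<^sup>2 \<le> K * (C x \<bullet> x)"
      using nonneg_operator_norm_le[OF C K(1)] K(2) by (simp add: mult.commute)
    have "(norm (A x))\<^sup>2 = (norm x)\<^sup>2 - (2 / K) * (C x \<bullet> x) + (1 / K\<^sup>2) * (norm (C x))\<^sup>2"
      by (simp add: A_def power2_norm_eq_inner inner_diff_left inner_diff_right inner_commute
          power2_eq_square[of K] diff_divide_distrib)
    also have "\<dots> \<le> (norm x)\<^sup>2 - (2 / K) * (C x \<bullet> x) + (1 / K\<^sup>2) * (K * (C x \<bullet> x))"
      using * by (intro add_left_mono mult_left_mono) auto
    also have "\<dots> = (norm x)\<^sup>2 - (C x \<bullet> x) / K"
      using K(1) by (simp add: field_simps power2_eq_square)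
    also have "\<dots> \<le> (norm x)\<^sup>2"
      using nonneg_operatorD(3)[OF C] K(1) by simp
    finally show ?thesis
      by (rule power2_le_imp_le) simp
  qed
  have A_sym: "A x \<bullet> y = x \<bullet> A y" for x y
    by (simp add: A_def inner_diff_left inner_diff_right nonneg_operatorD(2)[OF C])
  obtain S where S: "nonneg_operator S" "\<And>x. S (S x) = x - A x"
    "\<And>B x. bounded_linear B \<Longrightarrow> (\<And>x. B (A x) = A (B x)) \<Longrightarrow> B (S x) = S (B x)"
    using contraction_sqrt_exists[OF A_lin A_le A_sym] by blast
  interpret S: bounded_linear S using S(1) by (rule nonneg_operatorD)
  show ?thesis
  \<comment> \<open>Since \<open>S \<circ> S = 1 - A = C / K\<close>, the factor
    \<open>sqrt K\<close> undoes the rescaling.\<close>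
  proof (rule that[of "\<lambda>x. sqrt K *\<^sub>R S x"])
    show "nonneg_operator (\<lambda>x. sqrt K *\<^sub>R S x)"
      using S(1) K(1) by (intro nonneg_operator_scaleR) auto
    show "(\<lambda>x. sqrt K *\<^sub>R S x) \<circ> (\<lambda>x. sqrt K *\<^sub>R S x) = C"
      using K(1) by (auto simp: fun_eq_iff S.scaleR S(2) A_def)
  next
    fix B x assume B: "bounded_linear B" "\<And>x. B (C x) = C (B x)"
    interpret B: bounded_linear B by fact
    have "B (S x) = S (B x)"
      by (rule S(3)[OF B(1)]) (simp add: A_def B.diff B.scaleR B(2))
    then show "B (sqrt K *\<^sub>R S x) = sqrt K *\<^sub>R S (B x)"
      by (simp add: B.scaleR)
  qed
qed

text \<open>This makes the definite description in \<open>operator_sqrt\<close> meaningful. For a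
  second root \<open>T\<close>, commutation with \<open>S\<close> gives
  \<open>(S + T) (S - T) = 0\<close>, and nonnegativity then forces \<open>S = T\<close>.\<close>

lemma ex1_nonneg_operator_sqrt:
  fixes C :: "'a::{real_inner, complete_space} \<Rightarrow> 'a"
  assumes C: "nonneg_operator C"
  shows "\<exists>!S. nonneg_operator S \<and> S \<circ> S = C"
proof -
  obtain S where S: "nonneg_operator S" "S \<circ> S = C"
    and comm: "\<And>B x. bounded_linear B \<Longrightarrow> (\<And>x. B (C x) = C (B x)) \<Longrightarrow> B (S x) = S (B x)"
    using nonneg_operator_sqrt_exists[OF C] by blast
  have "T = S" if T: "nonneg_operator T" "T \<circ> T = C" for T
  proof
    fix x
    interpret S: bounded_linear S using S(1) by (rule nonneg_operatorD)
    interpret T: bounded_linear T using T(1) by (rule nonneg_operatorD)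
    have SS: "S (S x) = C x" and TT: "T (T x) = C x" for x
      using S(2) T(2) by (auto simp: fun_eq_iff)
    \<comment> \<open>\<open>T\<close> commutes with its own square \<open>C\<close>, hence with
      \<open>S\<close>.\<close>
    have TS: "T (S x) = S (T x)" for x
      by (rule comm[OF T.bounded_linear_axioms]) (simp flip: TT)
    define y where "y = S x - T x"
    have "S y + T y = 0"
      by (simp add: y_def S.diff T.diff SS TT TS)
    then have "S y \<bullet> y + T y \<bullet> y = 0"
      by (metis inner_add_left inner_zero_left)
    \<comment> \<open>Two nonnegative numbers with sum zero both vanish.\<close>
    then have "S y \<bullet> y = 0" "T y \<bullet> y = 0"
      using nonneg_operatorD(3)[OF S(1), of y] nonneg_operatorD(3)[OF T(1), of y] by linarith+
    then have "S y = 0" "T y = 0"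
      using nonneg_operator_eq_0 S(1) T(1) by blast+
    \<comment> \<open>Symmetry moves \<open>S - T\<close> from \<open>x\<close> onto
      \<open>y\<close>, where it vanishes.\<close>
    have "y \<bullet> y = x \<bullet> (S y - T y)"
      using nonneg_operatorD(2)[OF S(1), of x y] nonneg_operatorD(2)[OF T(1), of x y]
      by (metis inner_diff_left inner_diff_right y_def)
    then show "T x = S x"
      using \<open>S y = 0\<close> \<open>T y = 0\<close> by (simp add: y_def)
  qed
  then show ?thesis
    using S by blast
qed

section \<open>Linearity of the Cameron-Martin space\<close>

lemma nonneg_operator_operator_sqrt:
  fixes C :: "'a::{real_inner, complete_space} \<Rightarrow> 'a"
  assumes "nonneg_operator C"
  shows "nonneg_operator (operator_sqrt C)"
  unfolding operator_sqrt_def using theI'[OF ex1_nonneg_operator_sqrt[OF assms]] by blast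

lemma subspace_cameron_martin_space:
  fixes C :: "'a::{real_inner, complete_space} \<Rightarrow> 'a"
  assumes "nonneg_operator C"
  shows "subspace (cameron_martin_space C)"
  unfolding cameron_martin_space_def
  using nonneg_operatorD(1)[OF nonneg_operator_operator_sqrt[OF assms]]
  by (intro linear_subspace_image subspace_UNIV bounded_linear.linear)

lemma nonneg_operator_covariance:
  assumes "gaussian_measure_with m C M"
  shows "nonneg_operator C"
proof -
  have cov: "C h \<bullet> k = (LINT x|M. (h \<bullet> (x - m)) * (k \<bullet> (x - m)))" for h k
    using assms by (auto simp: gaussian_measure_with_def)
  have "C h \<bullet> k = h \<bullet> C k" for h k
    unfolding inner_commute[of h] cov by (simp add: mult.commute)
  moreover have "0 \<le> C h \<bullet> h" for h
    \<comment> \<open>The integrand is a square; by convention the integral of a nonintegrable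
      function is 0, so the bound holds in every case.\<close>
    unfolding cov by (rule Bochner_Integration.integral_nonneg) simp
  ultimately show ?thesis
    using assms by (auto simp: nonneg_operator_def gaussian_measure_with_def)
qed

section \<open>Planar layers\<close>

lemma range_layer_perturbation_subset:
  assumes "subspace V" "v \<in> V"
  shows "range (layer_perturbation v b) \<subseteq> V"
  using assms by (auto simp: layer_perturbation_def subspace_scale subspace_neg)

lemma finite_dimensional_range_layer_perturbation:
  "finite_dimensional_range (layer_perturbation v b)"
  unfolding finite_dimensional_range_def
  by (intro exI[of _ "span {v}"] conjI exI[of _ "{v}"] range_layer_perturbation_subset)
    (auto intro: span_base)

lemma bij_layer:
  assumes "v \<bullet> v = 1"
  shows "bij (layer v b)"
proof (rule o_bij)
  \<comment> \<open>The layer halves \<open>v \<bullet> x + b\<close>, as \<open>v\<close> is a unit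
    vector. Solving \<open>w = x - 0.5 (v \<bullet> x + b) v\<close> for \<open>x\<close> thus gives
    \<open>x = w + (v \<bullet> w + b) v\<close>.\<close>
  define g where "g w = w + (v \<bullet> w + b) *\<^sub>R v" for w
  have "v \<bullet> layer v b x + b = 0.5 * (v \<bullet> x + b)" for x
    using assms by (simp add: layer_def layer_perturbation_def inner_diff_right field_simps)
  then show "g \<circ> layer v b = id"
    by (simp add: g_def fun_eq_iff) (simp add: layer_def layer_perturbation_def)
  show "layer v b \<circ> g = id"
    using assms
    by (auto simp: g_def layer_def layer_perturbation_def fun_eq_iff inner_add_right
        algebra_simps)
qed

lemma has_derivative_layer_perturbation:
  "(layer_perturbation v b has_derivative (\<lambda>x. (- 0.5 * (v \<bullet> x)) *\<^sub>R v)) (at u)"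
  unfolding layer_perturbation_def[abs_def]
  by (auto intro!: derivative_eq_intros)

text \<open>Pair the eigenvalue equation with \<open>v\<close>: either the factor
  \<open>v \<bullet> x\<close> cancels, or it is zero and then \<open>l *\<^sub>R x = 0\<close> with
  \<open>x\<close> nonzero.\<close>

lemma point_spectrum_rank_one:
  assumes "l \<in> point_spectrum (\<lambda>x. (c * (v \<bullet> x)) *\<^sub>R v)"
  shows "l = 0 \<or> l = c * (v \<bullet> v)"
proof -
  obtain x where x: "x \<noteq> 0" "(c * (v \<bullet> x)) *\<^sub>R v = l *\<^sub>R x"
    using assms by (auto simp: point_spectrum_def)
  from x(2) have "v \<bullet> ((c * (v \<bullet> x)) *\<^sub>R v) = v \<bullet> (l *\<^sub>R x)"
    by simp
  then have "(c * (v \<bullet> v) - l) * (v \<bullet> x) = 0"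
    by (simp add: algebra_simps)
  then show ?thesis
    using x by auto
qed

text \<open>Differentiability is asserted explicitly since \<open>frechet_derivative\<close> is a
  choice operator and carries information only where a derivative exists.\<close>

theorem theorem2p4:
  fixes \<mu>\<^sub>0 :: "'a::{real_inner, complete_space, second_countable_topology} measure"
    and C\<^sub>0 :: "'a \<Rightarrow> 'a"
    and N :: nat and v :: "nat \<Rightarrow> 'a" and b :: "nat \<Rightarrow> real"
  assumes "gaussian_measure_with 0 C\<^sub>0 \<mu>\<^sub>0"
    and "\<And>n. n \<in> {1..N} \<Longrightarrow> v n \<in> cameron_martin_space C\<^sub>0"
    and "\<And>n. n \<in> {1..N} \<Longrightarrow> v n \<bullet> v n = 1"
  shows "\<forall>n\<in>{1..N}.
      range (layer_perturbation (v n) (b n)) \<subseteq> cameron_martin_space C\<^sub>0 \<and>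
      finite_dimensional_range (layer_perturbation (v n) (b n)) \<and>
      bij (layer (v n) (b n)) \<and>
      (\<forall>u. layer_perturbation (v n) (b n) differentiable (at u) \<and>
           point_spectrum (frechet_derivative (layer_perturbation (v n) (b n)) (at u)) \<inter> {..-1} = {})"
proof (intro ballI conjI allI)
  fix n u assume n: "n \<in> {1..N}"
  show "range (layer_perturbation (v n) (b n)) \<subseteq> cameron_martin_space C\<^sub>0"
    using assms(1,2) n
    by (intro range_layer_perturbation_subset subspace_cameron_martin_space
        nonneg_operator_covariance)
  show "finite_dimensional_range (layer_perturbation (v n) (b n))"
    by (rule finite_dimensional_range_layer_perturbation)
  show "bij (layer (v n) (b n))"
    by (rule bij_layer[OF assms(3)[OF n]])
  show "layer_perturbation (v n) (b n) differentiable (at u)"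
    using has_derivative_layer_perturbation by (rule differentiableI)
  show "point_spectrum (frechet_derivative (layer_perturbation (v n) (b n)) (at u)) \<inter> {..-1} = {}"
    \<comment> \<open>By uniqueness of the derivative this is the rank-one map with
      \<open>c = -0.5\<close>. As \<open>v n\<close> is a unit vector, its eigenvalues can only be 0
      or -1/2, both above -1.\<close>
    unfolding frechet_derivative_at[OF has_derivative_layer_perturbation, symmetric]
    using assms(3)[OF n] by (fastforce dest: point_spectrum_rank_one)
qed

end
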